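(* Let $k\geq 1$, let $(X,d)$ be a compact metric space, let $T:\mathbb{Z}^k\times X\to X$ be an expansive continuous action, and let $R:\mathbb{Z}^{k-1}\times X\to X$ be a continuous action commuting with $T$, i.e. $T^v\circ R^u=R^u\circ T^v$ for all $v\in\mathbb{Z}^k$, $u\in\mathbb{Z}^{k-1}$. Then $\mathrm{mdim}(X,R)<\infty$.
   Context: A continuous action $T:\mathbb{Z}^k\times X\to X$ on a compact metric space $(X,d)$ is expansive if there is $c>0$ such that any two distinct $x,y\in X$ satisfy $\sup_{u\in\mathbb{Z}^k}d(T^ux,T^uy)>c$. Mean dimension: for an open cover $\mathcal{U}$ of $X$, its order $\mathrm{ord}(\mathcal{U})$ is the largest $n\geq 0$ such that some $n+1$ distinct members of $\mathcal{U}$ have nonempty common intersection, and $\mathrm{mesh}(\mathcal{U},\rho)$ is the supremum of the $\rho$-diameters of its members. For a metric $\rho$ and $\varepsilon>0$, $\mathrm{widim}_\varepsilon(X,\rho)$ is the minimum of $\mathrm{ord}(\mathcal{U})$ over open covers $\mathcal{U}$ with $\mathrm{mesh}(\mathcal{U},\rho)\leq\varepsilon$. For a continuous action $S$ of $\mathbb{Z}^m$ on $X$ and $\Omega\subset\mathbb{R}^m$, let $d^S_\Omega(x,y)=\sup_{u\in\Omega\cap\mathbb{Z}^m}d(S^ux,S^uy)$. The mean dimension is $\mathrm{mdim}(X,S)=\lim_{\varepsilon\to0}\lim_{N\to\infty}\mathrm{widim}_\varepsilon(X,d^S_{[-N,N]^m})/(2N+1)^m$ (for $m=0$ this equals the topological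 dimension of $X$). *)

theory Defs
  imports "HOL-Analysis.Analysis" "HOL-Library.Extended_Nat" "HOL-Library.Extended_Real" "HOL-Library.Function_Algebras"
begin

definition Zk :: "nat \<Rightarrow> (nat \<Rightarrow> int) set" where
  "Zk k = {u. \<forall>i\<ge>k. u i = 0}"

definition cube_pts :: "nat \<Rightarrow> nat \<Rightarrow> (nat \<Rightarrow> int) set" where
  "cube_pts m N = {u \<in> Zk m. \<forall>i<m. \<bar>u i\<bar> \<le> int N}"

text \<open>A continuous action of Z^k on X (Z^k discrete, so continuity means every
  map T u is continuous on X).\<close>
definition cont_action :: "nat \<Rightarrow> 'a::metric_space set \<Rightarrow> ((nat \<Rightarrow> int) \<Rightarrow> 'a \<Rightarrow> 'a) \<Rightarrow> bool" where
  "cont_action k X T \<longleftrightarrow>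
     (\<forall>u\<in>Zk k. T u ` X \<subseteq> X \<and> continuous_on X (T u)) \<and>
     (\<forall>x\<in>X. T 0 x = x) \<and>
     (\<forall>u\<in>Zk k. \<forall>v\<in>Zk k. \<forall>x\<in>X. T (u + v) x = T u (T v x))"

definition expansive :: "nat \<Rightarrow> 'a::metric_space set \<Rightarrow> ((nat \<Rightarrow> int) \<Rightarrow> 'a \<Rightarrow> 'a) \<Rightarrow> bool" where
  "expansive k X T \<longleftrightarrow>
     (\<exists>c>0. \<forall>x\<in>X. \<forall>y\<in>X. x \<noteq> y \<longrightarrow> (\<exists>u\<in>Zk k. dist (T u x) (T u y) > c))"

definition open_cover :: "'a::topological_space set \<Rightarrow> 'a set set \<Rightarrow> bool" where
  "open_cover X U \<longleftrightarrow> (\<forall>A\<in>U. openin (top_of_set X) A) \<and> \<Union>U = X"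

definition cover_ord :: "'a set set \<Rightarrow> enat" where
  "cover_ord U = Sup {enat n | n. \<exists>V\<subseteq>U. finite V \<and> card V = Suc n \<and> \<Inter>V \<noteq> {}}"

definition mesh :: "('a \<Rightarrow> 'a \<Rightarrow> real) \<Rightarrow> 'a set set \<Rightarrow> ereal" where
  "mesh \<rho> U = (SUP A\<in>U. SUP x\<in>A. SUP y\<in>A. ereal (\<rho> x y))"

definition widim :: "'a::topological_space set \<Rightarrow> ('a \<Rightarrow> 'a \<Rightarrow> real) \<Rightarrow> real \<Rightarrow> enat" where
  "widim X \<rho> \<epsilon> = (INF U\<in>{U. open_cover X U \<and> mesh \<rho> U \<le> ereal \<epsilon>}. cover_ord U)"

definition dyn_dist :: "nat \<Rightarrow> ((nat \<Rightarrow> int) \<Rightarrow> 'a \<Rightarrow> 'a) \<Rightarrow> nat \<Rightarrow> 'a::metric_space \<Rightarrow> 'a \<Rightarrow> real" where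
  "dyn_dist m S N x y = (SUP u\<in>cube_pts m N. dist (S u x) (S u y))"

text \<open>Mean dimension; the limits are taken as upper limits (they coincide with
  the limits whenever these exist).\<close>
definition mdim :: "nat \<Rightarrow> 'a::metric_space set \<Rightarrow> ((nat \<Rightarrow> int) \<Rightarrow> 'a \<Rightarrow> 'a) \<Rightarrow> ereal" where
  "mdim m X S = Limsup (at_right 0) (\<lambda>\<epsilon>::real.
      limsup (\<lambda>N. ereal_of_enat (widim X (dyn_dist m S N) \<epsilon>) / ereal (real (2*N+1) ^ m)))"

end

theory Submission
  imports Defs "HOL-Real_Asymp.Real_Asymp"
begin

text \<open>Put W n x y for d(T^v x, T^v y) < c on |v| \<le> nL. For L large, expansiveness gives
  W (n+1) O W (n+1) \<subseteq> W n, and, as R commutes with T, the generators of R map W (n+1) into W n;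
  hence W 2N is mapped into W N by all R^u with |u| \<le> N. Itineraries show that X is a union of
  exp(O(N^k)) sets A with A \<times> A \<subseteq> W 2N, so R^u (|u| \<le> N) moves any two points of one A to
  points at most one W N-step apart. On the other hand about 2^N such steps are needed to leave an
  entourage of fixed size. Take a finite net, depending only on \<epsilon>, of small open sets and consider
  the W N-step distances of R^u x to them, each with a threshold chosen among 2^(N/2) values. By
  counting, the thresholds can be chosen so that for every x at most n = O(N^(k-1)) of these
  distances are near their thresholds: a failure on one of the exp(O(N^k)) sets has probability
  about 2^(-nN/2). The cells cut out by such thresholds form a cover of order at most n, and n does
  not depend on \<epsilon>.\<close>

subsection \<open>Covers of small order from thresholds\<close>

text \<open>A union bound. For fixed \<open>c\<close> and a set \<open>S\<close> of
  \<open>Suc n\<close> indices, requiring \<open>t i \<in> F c i\<close> on all of \<open>S\<close>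
  leaves at most one value at each index of \<open>S\<close>, hence at most
  \<open>Q ^ (card I - Suc n)\<close> of the \<open>Q ^ card I\<close> choices. There are at most
  \<open>card C * card I ^ Suc n\<close> pairs \<open>(c, S)\<close>, so \<open>less\<close> leaves
  a choice that avoids all of them.\<close>

lemma exists_sparse_choice:
  fixes F :: "'c \<Rightarrow> 'i \<Rightarrow> nat set"
  assumes "finite I" "finite C"
    and F: "\<And>c i. c \<in> C \<Longrightarrow> i \<in> I \<Longrightarrow> card (F c i \<inter> {..<Q}) \<le> 1"
    and less: "card C * card I ^ Suc n < Q ^ Suc n"
  shows "\<exists>t. (\<forall>i\<in>I. t i < Q) \<and> (\<forall>c\<in>C. card {i\<in>I. t i \<in> F c i} \<le> n)"
proof (cases "card I \<le> n")
  case True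
  have "Q > 0"
    using less by (cases "Q = 0") auto
  moreover have "card {i\<in>I. (0::nat) \<in> F c i} \<le> n" for c
    using True card_mono[OF \<open>finite I\<close>, of "{i\<in>I. (0::nat) \<in> F c i}"] by auto
  ultimately show ?thesis
    by (intro exI[of _ "\<lambda>_. 0"]) auto
next
  case False
  define K where "K = card I"
  \<comment> \<open>This keeps the exponent \<open>K - Suc n\<close> below from truncating; in the
    other case every choice works.\<close>
  have K: "Suc n \<le> K"
    using False K_def by simp
  have "Q > 0"
    using less by (cases "Q = 0") auto
  define Choices where "Choices = PiE I (\<lambda>_. {..<Q})"
  define \<S> where "\<S> = {S. S \<subseteq> I \<and> card S = Suc n}"
  define Bad where "Bad c S = PiE I (\<lambda>i. if i \<in> S then F c i \<inter> {..<Q} else {..<Q})" for c S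
  have finS: "finite \<S>"
    unfolding \<S>_def using \<open>finite I\<close> by simp
  have cardS: "card \<S> \<le> K ^ Suc n"
    using n_subsets[OF \<open>finite I\<close>, of "Suc n"] binomial_le_pow[OF K]
    unfolding \<S>_def K_def by simp
  have card_Bad: "card (Bad c S) \<le> Q ^ (K - Suc n)" if "c \<in> C" "S \<in> \<S>" for c S
  proof -
    have S: "S \<subseteq> I" "card S = Suc n"
      using that \<S>_def by auto
    have "card (Bad c S) = (\<Prod>i\<in>I. card (if i \<in> S then F c i \<inter> {..<Q} else {..<Q}))"
      unfolding Bad_def using \<open>finite I\<close> by (rule card_PiE)
    also have "\<dots> \<le> (\<Prod>i\<in>I. if i \<in> S then 1 else Q)"
      by (intro prod_mono) (use F[OF that(1)] in auto)
    also have "\<dots> = Q ^ card (I - S)"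
      using \<open>finite I\<close> by (simp add: prod.If_cases Diff_eq)
    also have "card (I - S) = K - Suc n"
      using S \<open>finite I\<close> by (simp add: K_def card_Diff_subset finite_subset)
    finally show ?thesis .
  qed
  have "card (\<Union>c\<in>C. \<Union>S\<in>\<S>. Bad c S) \<le> (\<Sum>c\<in>C. \<Sum>S\<in>\<S>. Q ^ (K - Suc n))"
    by (rule order.trans[OF card_UN_le[OF \<open>finite C\<close>]], rule sum_mono)
       (rule order.trans[OF card_UN_le[OF finS]], rule sum_mono, simp add: card_Bad)
  also have "\<dots> = card C * card \<S> * Q ^ (K - Suc n)"
    by simp
  also have "\<dots> \<le> card C * K ^ Suc n * Q ^ (K - Suc n)"
    using cardS by (intro mult_le_mono) auto
  also have "\<dots> < Q ^ Suc n * Q ^ (K - Suc n)"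
    using less \<open>Q > 0\<close> unfolding K_def by (intro mult_strict_right_mono) auto
  also have "\<dots> = card Choices"
    using K \<open>finite I\<close>
    by (simp only: power_add[symmetric] Choices_def card_PiE prod_constant card_lessThan)
       (simp add: K_def)
  finally have *: "card (\<Union>c\<in>C. \<Union>S\<in>\<S>. Bad c S) < card Choices" .
  have "finite (\<Union>c\<in>C. \<Union>S\<in>\<S>. Bad c S)"
    unfolding Bad_def using \<open>finite C\<close> finS \<open>finite I\<close> by (intro finite_UN_I finite_PiE) auto
  then have "\<not> Choices \<subseteq> (\<Union>c\<in>C. \<Union>S\<in>\<S>. Bad c S)"
    using * card_mono leD by blast
  then obtain t where t: "t \<in> Choices" "t \<notin> (\<Union>c\<in>C. \<Union>S\<in>\<S>. Bad c S)"
    by blast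
  have "card {i\<in>I. t i \<in> F c i} \<le> n" if "c \<in> C" for c
  proof (rule ccontr)
    assume "\<not> ?thesis"
    then obtain S where S: "S \<subseteq> {i\<in>I. t i \<in> F c i}" "card S = Suc n"
      by (meson Suc_leI linorder_not_le obtain_subset_with_card_n)
    then have "t \<in> Bad c S"
      using t(1) unfolding Bad_def Choices_def PiE_iff by auto
    moreover have "S \<in> \<S>"
      using S \<S>_def by auto
    ultimately show False
      using t(2) that by blast
  qed
  then show ?thesis
    using t(1) unfolding Choices_def by (intro exI[of _ t]) auto
qed

text \<open>At level j, coordinate i of a point is inside, undecided or outside according as the point lies
  in E i (t i - j), in E i (t i + j) minus the closure of E i (t i - j), or outside the closure of
  E i (t i + j). These conditions are open and mutually exclusive, and the cells consist of
  the points having exactly j undecided coordinates and a prescribed pattern. Coordinates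
  satisfying none of the three become undecided at level j+1, so if no level j \<le> n suits x, then
  x has at least n+1 undecided coordinates at level n+1.\<close>

lemma nested_family_cover:
  fixes X :: "'a::metric_space set" and E :: "'i \<Rightarrow> nat \<Rightarrow> 'a set" and t :: "'i \<Rightarrow> nat"
  assumes "finite I"
    and op: "\<And>i s. i \<in> I \<Longrightarrow> openin (top_of_set X) (E i s)"
    and cl: "\<And>i s. i \<in> I \<Longrightarrow> X \<inter> closure (E i s) \<subseteq> E i (Suc s)"
    and t: "\<And>i. i \<in> I \<Longrightarrow> Suc n \<le> t i"
    and few: "\<And>x. x \<in> X \<Longrightarrow>
      card {i\<in>I. x \<in> E i (t i + Suc n) \<and> x \<notin> closure (E i (t i - Suc n))} \<le> n"
  shows "\<exists>U. open_cover X U \<and> cover_ord U \<le> enat n \<and>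
    (\<forall>A\<in>U. \<forall>x\<in>A. \<forall>y\<in>A. \<forall>i\<in>I. x \<in> E i 0 \<longrightarrow> y \<in> E i (t i))"
proof -
  have sub: "E i s \<subseteq> X" if "i \<in> I" for i s
    using op[OF that] openin_imp_subset by blast
  have mono: "E i s \<subseteq> E i s'" if "i \<in> I" "s \<le> s'" for i s s'
    using that(2)
  proof (induction s' rule: dec_induct)
    case (step r)
    have "E i r \<subseteq> E i (Suc r)"
      using cl[OF that(1), of r] sub[OF that(1), of r] closure_subset[of "E i r"] by blast
    then show ?case
      using step by blast
  qed auto
  define Z where "Z j x = {i\<in>I. x \<in> E i (t i + j) \<and> x \<notin> closure (E i (t i - j))}" for j x
  define In where "In j x = {i\<in>I. x \<in> E i (t i - j)}" for j x
  define Out where "Out j x = {i\<in>I. x \<notin> closure (E i (t i + j))}" for j x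
  \<comment> \<open>Inclusions rather than equalities, because they are finitely many open
    conditions. For \<open>good j x\<close> they become equalities: the three sets of
    \<open>x\<close> exhaust \<open>I\<close>, and those of \<open>y\<close> are pairwise
    disjoint.\<close>
  define cell where "cell j x = {y\<in>X. Z j x \<subseteq> Z j y \<and> In j x \<subseteq> In j y \<and> Out j x \<subseteq> Out j y}" for j x
  define good where "good j x \<longleftrightarrow> x \<in> X \<and> j \<le> n \<and> card (Z j x) = j \<and> Z j x \<union> In j x \<union> Out j x = I" for j x
  define U where "U = {cell j x |j x. good j x}"
  have disj: "Z j y \<inter> In j y = {}" "Z j y \<inter> Out j y = {}" "In j y \<inter> Out j y = {}" for j y
  proof -
    have "E i (t i - j) \<subseteq> closure (E i (t i - j))" "E i (t i - j) \<subseteq> closure (E i (t i + j))"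
      "E i (t i + j) \<subseteq> closure (E i (t i + j))" if "i \<in> I" for i
      using mono[OF that, of "t i - j" "t i + j"] closure_subset by fastforce+
    then show "Z j y \<inter> In j y = {}" "Z j y \<inter> Out j y = {}" "In j y \<inter> Out j y = {}"
      unfolding Z_def In_def Out_def by blast+
  qed
  have eq: "Z j y = Z j x \<and> In j y = In j x \<and> Out j y = Out j x"
    if "good j x" "y \<in> cell j x" for j x y
  proof -
    have "Z j x \<subseteq> Z j y" "In j x \<subseteq> In j y" "Out j x \<subseteq> Out j y" "Z j x \<union> In j x \<union> Out j x = I"
      using that unfolding cell_def good_def by auto
    moreover have "Z j y \<subseteq> I" "In j y \<subseteq> I" "Out j y \<subseteq> I"
      unfolding Z_def In_def Out_def by auto
    ultimately show ?thesis
      using disj[of j y] by blast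
  qed
  have cell_open: "openin (top_of_set X) (cell j x)" for j x
  proof -
    define P where "P i = (if i \<in> Z j x then {y\<in>X. i \<in> Z j y} else X) \<inter>
      ((if i \<in> In j x then {y\<in>X. i \<in> In j y} else X) \<inter>
       (if i \<in> Out j x then {y\<in>X. i \<in> Out j y} else X))" for i
    have co: "openin (top_of_set X) {y\<in>X. y \<notin> closure A}" for A
    proof -
      have "{y\<in>X. y \<notin> closure A} = X \<inter> - closure A"
        by auto
      then show ?thesis
        by (simp add: openin_open_Int open_Compl)
    qed
    have "openin (top_of_set X) (P i)" if "i \<in> I" for i
    proof -
      have "{y\<in>X. i \<in> Z j y} = E i (t i + j) \<inter> {y\<in>X. y \<notin> closure (E i (t i - j))}"
        using that sub unfolding Z_def by auto
      then have "openin (top_of_set X) {y\<in>X. i \<in> Z j y}"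
        using op[OF that] co by auto
      moreover have "{y\<in>X. i \<in> In j y} = E i (t i - j)"
        using that sub unfolding In_def by auto
      then have "openin (top_of_set X) {y\<in>X. i \<in> In j y}"
        using op[OF that] by auto
      moreover have "{y\<in>X. i \<in> Out j y} = {y\<in>X. y \<notin> closure (E i (t i + j))}"
        using that unfolding Out_def by auto
      then have "openin (top_of_set X) {y\<in>X. i \<in> Out j y}"
        using co by auto
      ultimately show ?thesis
        unfolding P_def by (intro openin_Int) auto
    qed
    \<comment> \<open>Intersecting with \<open>X\<close> covers the case of empty \<open>I\<close>,
      where the indexed intersection is the whole type.\<close>
    then have "openin (top_of_set X) (X \<inter> (\<Inter>i\<in>I. P i))"
      using \<open>finite I\<close> by (cases "I = {}") (auto intro!: openin_Int openin_INT2)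
    moreover have "cell j x = X \<inter> (\<Inter>i\<in>I. P i)"
    proof -
      have "Z j x \<subseteq> I" "In j x \<subseteq> I" "Out j x \<subseteq> I"
        unfolding Z_def In_def Out_def by auto
      then show ?thesis
        unfolding cell_def P_def by (auto split: if_splits)
    qed
    ultimately show ?thesis
      by simp
  qed
  have ex_good: "\<exists>j. good j x" if "x \<in> X" for x
  proof (rule ccontr)
    assume bad: "\<nexists>j. good j x"
    have "j \<le> card (Z j x)" if "j \<le> Suc n" for j
      using that
    proof (induction j)
      case (Suc j)
      then have j: "j \<le> card (Z j x)" "j \<le> n"
        by auto
      have sub': "Z j x \<union> (I - (In j x \<union> Out j x)) \<subseteq> Z (Suc j) x"
      proof
        fix i assume i: "i \<in> Z j x \<union> (I - (In j x \<union> Out j x))"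
        then have iI: "i \<in> I"
          unfolding Z_def by auto
        have 1: "x \<in> closure (E i (t i + j))"
          using i closure_subset[of "E i (t i + j)"] unfolding Z_def Out_def by blast
        have 2: "x \<notin> E i (t i - j)"
          using i closure_subset[of "E i (t i - j)"] unfolding Z_def In_def by blast
        \<comment> \<open>Here \<open>Suc n \<le> t i\<close> enters: as \<open>j \<le> n\<close>,
          the threshold can still be lowered by one without truncation.\<close>
        have "Suc (t i - Suc j) = t i - j"
          using t[OF iI] j by auto
        then have "x \<notin> closure (E i (t i - Suc j))"
          using cl[OF iI, of "t i - Suc j"] 2 \<open>x \<in> X\<close> by auto
        moreover have "x \<in> E i (t i + Suc j)"
          using cl[OF iI, of "t i + j"] 1 \<open>x \<in> X\<close> by auto
        ultimately show "i \<in> Z (Suc j) x"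
          using iI unfolding Z_def by auto
      qed
      have fin: "finite (Z (Suc j) x)"
        unfolding Z_def using \<open>finite I\<close> by auto
      show ?case
      proof (cases "card (Z j x) = j")
        case True
        then have "Z j x \<union> In j x \<union> Out j x \<noteq> I"
          using bad j \<open>x \<in> X\<close> unfolding good_def by blast
        then obtain i where "i \<in> I" "i \<notin> Z j x \<union> In j x \<union> Out j x"
          unfolding Z_def In_def Out_def by blast
        then have "insert i (Z j x) \<subseteq> Z (Suc j) x" "i \<notin> Z j x"
          using sub' by auto
        moreover have "finite (Z j x)"
          unfolding Z_def using \<open>finite I\<close> by auto
        ultimately show ?thesis
          using card_mono[OF fin, of "insert i (Z j x)"] True by simp
      next
        case False
        then show ?thesis
          using j card_mono[OF fin, of "Z j x"] sub' by auto
      qed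
    qed simp
    from this[of "Suc n"] few[OF that] show False
      unfolding Z_def by simp
  qed
  have "\<Union>U = X"
  proof
    show "\<Union>U \<subseteq> X"
      unfolding U_def cell_def by auto
    show "X \<subseteq> \<Union>U"
    proof
      fix x assume "x \<in> X"
      then obtain j where "good j x"
        using ex_good by blast
      moreover have "x \<in> cell j x"
        using \<open>x \<in> X\<close> unfolding cell_def by simp
      ultimately show "x \<in> \<Union>U"
        unfolding U_def by blast
    qed
  qed
  with cell_open have "open_cover X U"
    unfolding open_cover_def U_def by blast
  moreover have "cover_ord U \<le> enat n"
    unfolding cover_ord_def
  proof (rule Sup_least, clarify)
    fix n' V assume V: "V \<subseteq> U" "finite V" "card V = Suc n'" "\<Inter>V \<noteq> {}"
    then obtain y where y: "\<And>A. A \<in> V \<Longrightarrow> y \<in> A"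
      by blast
    \<comment> \<open>A cell containing \<open>y\<close> is determined by its level, being
      \<open>cell j y\<close>. Hence at most one cell per level \<open>j \<le> n\<close> contains
      \<open>y\<close>, which bounds the order by \<open>n\<close>.\<close>
    have "V \<subseteq> (\<lambda>j. cell j y) ` {..n}"
    proof
      fix A assume "A \<in> V"
      then obtain j x where jx: "A = cell j x" "good j x"
        using V(1) U_def by blast
      then have "cell j x = cell j y"
        using eq[OF jx(2), of y] y[OF \<open>A \<in> V\<close>] unfolding cell_def by simp
      then show "A \<in> (\<lambda>j. cell j y) ` {..n}"
        using jx unfolding good_def by auto
    qed
    then have "card V \<le> Suc n"
      using surj_card_le[of "{..n}" V] by simp
    then show "enat n' \<le> enat n"
      using V by simp
  qed
  moreover have "y \<in> E i (t i)"
    if A: "A \<in> U" "x \<in> A" "y \<in> A" and that: "i \<in> I" "x \<in> E i 0" for A x y i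
  proof -
    obtain j z where jz: "A = cell j z" "good j z"
      using A(1) U_def by blast
    then have "In j x = In j y"
      using eq A by metis
    moreover have "i \<in> In j x"
      using that mono[of i 0 "t i - j"] unfolding In_def by auto
    ultimately show ?thesis
      using mono[of i "t i - j" "t i"] that unfolding In_def by auto
  qed
  ultimately show ?thesis
    by blast
qed

text \<open>For a pair \<open>(u, p)\<close>, the points that \<open>\<rho> u\<close> maps within
  \<open>s\<close> steps of \<open>W\<close> from \<open>B p\<close> form an open set whose closure
  is absorbed by one further step, so \<open>nested_family_cover\<close> applies. Its sparseness
  condition concerns all points of \<open>X\<close>, but points of one \<open>\<Phi>\<close>-class
  stay one step apart under every \<open>\<rho> u\<close>, so thresholds need only suit one
  representative per class, and \<open>exists_sparse_choice\<close> supplies them.\<close>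

lemma entourage_chain_cover:
  fixes X :: "'a::metric_space set" and W :: "'a \<Rightarrow> 'a \<Rightarrow> bool"
    and \<rho> :: "'u \<Rightarrow> 'a \<Rightarrow> 'a" and B :: "'p \<Rightarrow> 'a set" and \<Phi> :: "'a \<Rightarrow> 'c"
  assumes fin: "finite G" "finite P" "finite C"
    and WX: "\<And>x y. W x y \<Longrightarrow> x \<in> X \<and> y \<in> X"
    and refl: "\<And>x. x \<in> X \<Longrightarrow> W x x"
    and sym: "\<And>x y. W x y \<Longrightarrow> W y x"
    and op: "\<And>x. x \<in> X \<Longrightarrow> openin (top_of_set X) {y. W x y}"
    and \<rho>: "\<And>u. u \<in> G \<Longrightarrow> continuous_on X (\<rho> u)" "\<And>u. u \<in> G \<Longrightarrow> \<rho> u ` X \<subseteq> X"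
    and B: "\<And>p. p \<in> P \<Longrightarrow> openin (top_of_set X) (B p)" "X \<subseteq> (\<Union>p\<in>P. B p)"
    and \<Phi>: "\<Phi> ` X \<subseteq> C"
      "\<And>x y u. x \<in> X \<Longrightarrow> y \<in> X \<Longrightarrow> u \<in> G \<Longrightarrow> \<Phi> x = \<Phi> y \<Longrightarrow> W (\<rho> u x) (\<rho> u y)"
    and less: "card C * (card G * card P) ^ Suc n < Q ^ Suc n"
  shows "\<exists>U. open_cover X U \<and> cover_ord U \<le> enat n \<and>
    (\<forall>A\<in>U. \<forall>x\<in>A. \<forall>y\<in>A. \<forall>u\<in>G. \<exists>p\<in>P. \<exists>s\<le>(2*n+4)*Q. \<exists>b\<in>B p.
        \<rho> u x \<in> B p \<and> (W ^^ s) b (\<rho> u y))"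
proof -
  define reach where "reach p s = {y. \<exists>b\<in>B p. (W ^^ s) b y}" for p s
  have reach_0: "reach p 0 = B p" for p
    unfolding reach_def by auto
  have reach_Suc: "reach p (Suc s) = (\<Union>x\<in>reach p s. {y. W x y})" for p s
    unfolding reach_def by auto
  have reach_X: "reach p s \<subseteq> X" if "p \<in> P" for p s
    using WX B(1)[OF that] openin_imp_subset reach_0 reach_Suc by (cases s) fastforce+
  have reach_mono: "reach p s \<subseteq> reach p s'" if "p \<in> P" "s \<le> s'" for p s s'
    using that(2) by (induction s' rule: dec_induct)
      (use reach_X[OF that(1)] reach_Suc refl in blast)+
  have reach_open: "openin (top_of_set X) (reach p s)" if "p \<in> P" for p s
    using B(1)[OF that] op reach_X[OF that] by (induction s) (auto simp: reach_0 reach_Suc)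
  define E where "E = (\<lambda>(u,p) s. {x\<in>X. \<rho> u x \<in> reach p s})"
  have E_open: "openin (top_of_set X) (E i s)" if iI: "i \<in> G \<times> P" for i s
  proof -
    obtain u p where i: "i = (u, p)" "u \<in> G" "p \<in> P"
      using iI by blast
    have "E i s = X \<inter> \<rho> u -` reach p s"
      unfolding E_def i by auto
    then show ?thesis
      using continuous_openin_preimage[of X "\<rho> u" X "reach p s"] \<rho>[OF i(2)] reach_open[OF i(3)]
      by auto
  qed
  have E_mono: "E i s \<subseteq> E i s'" if "i \<in> G \<times> P" "s \<le> s'" for i s s'
    using that reach_mono unfolding E_def by fastforce
  \<comment> \<open>The points that \<open>\<rho> u\<close> sends into the
    \<open>W\<close>-neighbourhood of \<open>\<rho> u x\<close> form a neighbourhood of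
    \<open>x\<close>, so some \<open>z\<close> of \<open>E i s\<close> is among them. By symmetry
    one step leads from \<open>\<rho> u z\<close> to \<open>\<rho> u x\<close>.\<close>
  have E_cl: "X \<inter> closure (E i s) \<subseteq> E i (Suc s)" if iI: "i \<in> G \<times> P" for i s
  proof
    fix x assume x: "x \<in> X \<inter> closure (E i s)"
    obtain u p where i: "i = (u, p)" "u \<in> G" "p \<in> P"
      using iI by blast
    have \<rho>x: "\<rho> u x \<in> X"
      using x \<rho>(2)[OF i(2)] by auto
    have "openin (top_of_set X) (X \<inter> \<rho> u -` {y. W (\<rho> u x) y})"
      by (intro continuous_openin_preimage[of X "\<rho> u" X]) (use \<rho>[OF i(2)] op[OF \<rho>x] in auto)
    then obtain O' where O': "open O'" "X \<inter> \<rho> u -` {y. W (\<rho> u x) y} = X \<inter> O'"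
      unfolding openin_open by blast
    have "x \<in> O'"
      using refl[OF \<rho>x] x O'(2) by auto
    then obtain z where "z \<in> O'" "z \<in> E i s"
      using x O'(1) by (metis IntD2 closure_iff_nhds_not_empty disjoint_iff order_refl)
    then have "z \<in> X" "\<rho> u z \<in> reach p s" "W (\<rho> u z) (\<rho> u x)"
      using O'(2) sym unfolding E_def i by auto
    then show "x \<in> E i (Suc s)"
      using x by (auto simp: E_def i reach_Suc)
  qed
  \<comment> \<open>The candidates are so far apart that a representative of a \<open>\<Phi>\<close>-class is near at most one.\<close>
  define \<theta> where "\<theta> q = (2*n+4) * Suc q" for q
  define rep where "rep c = (SOME x. x \<in> X \<and> \<Phi> x = c)" for c
  \<comment> \<open>The window has radius \<open>n+2\<close>, one more than the \<open>Suc n\<close>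
    of \<open>nested_family_cover\<close>, to absorb the single step between a point and its
    representative.\<close>
  define F where "F c i = {q. rep c \<in> E i (\<theta> q + (n+2)) \<and> rep c \<notin> E i (\<theta> q - (n+2))}" for c i
  have "card (F c i \<inter> {..<Q}) \<le> 1" if i: "i \<in> G \<times> P" for c i
  proof -
    have no: False if "q < q'" "q \<in> F c i" "q' \<in> F c i" for q q'
    proof -
      have "(2*n+4) * (q + 2) \<le> (2*n+4) * Suc q'"
        using that(1) by (intro mult_le_mono) auto
      \<comment> \<open>The spacing \<open>2*n+4\<close> is twice the radius of the window, so
        windows of different candidates do not overlap.\<close>
      then have "\<theta> q + (n+2) \<le> \<theta> q' - (n+2)"
        unfolding \<theta>_def by (simp add: algebra_simps)
      then show False
        using E_mono[OF i] that(2,3) unfolding F_def by blast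
    qed
    have "q = q'" if "q \<in> F c i" "q' \<in> F c i" for q q'
      using no that by (metis linorder_neqE_nat)
    then show ?thesis
      using card_le_Suc0_iff_eq[of "F c i \<inter> {..<Q}"] by auto
  qed
  then have "\<exists>q. (\<forall>i\<in>G \<times> P. q i < Q) \<and> (\<forall>c\<in>C. card {i \<in> G \<times> P. q i \<in> F c i} \<le> n)"
    using exists_sparse_choice[of "G \<times> P" C F Q n] fin less unfolding card_cartesian_product by blast
  then obtain q where q: "\<forall>i\<in>G \<times> P. q i < Q"
      "\<forall>c\<in>C. card {i \<in> G \<times> P. q i \<in> F c i} \<le> n"
    by (elim exE conjE)
  define t where "t i = \<theta> (q i)" for i
  \<comment> \<open>The reason for \<open>Suc q\<close> in \<open>\<theta>\<close>: even the
    smallest threshold permits subtracting \<open>n+2\<close>.\<close>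
  have t_ge: "2*n+4 \<le> t i" for i
    unfolding t_def \<theta>_def by simp
  have t_le: "t i \<le> (2*n+4) * Q" if "i \<in> G \<times> P" for i
    unfolding t_def \<theta>_def using bspec[OF q(1) that] by (intro mult_le_mono) auto
  have "\<exists>U. open_cover X U \<and> cover_ord U \<le> enat n \<and>
    (\<forall>A\<in>U. \<forall>x\<in>A. \<forall>y\<in>A. \<forall>i\<in>G \<times> P. x \<in> E i 0 \<longrightarrow> y \<in> E i (t i))"
  proof (rule nested_family_cover[where E = E and t = t and I = "G \<times> P"])
    show "finite (G \<times> P)"
      using fin by simp
    show "Suc n \<le> t i" for i
      using t_ge[of i] by simp
    fix x assume x: "x \<in> X"
    let ?c = "\<Phi> x"
    have rep: "rep ?c \<in> X" "\<Phi> (rep ?c) = \<Phi> x"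
      unfolding rep_def using someI[of "\<lambda>y. y \<in> X \<and> \<Phi> y = \<Phi> x" x] x by auto
    have "{i \<in> G \<times> P. x \<in> E i (t i + Suc n) \<and> x \<notin> closure (E i (t i - Suc n))}
      \<subseteq> {i \<in> G \<times> P. q i \<in> F ?c i}"
    proof
      fix i assume i: "i \<in> {i \<in> G \<times> P. x \<in> E i (t i + Suc n) \<and> x \<notin> closure (E i (t i - Suc n))}"
      then obtain u p where up: "i = (u, p)" "u \<in> G" "p \<in> P"
        by blast
      have 1: "x \<in> E (u, p) (t (u, p) + Suc n)"
        and 2: "x \<notin> closure (E (u, p) (t (u, p) - Suc n))"
        using i up by auto
      have w: "W (\<rho> u x) (\<rho> u (rep ?c))"
        using \<Phi>(2)[OF x rep(1) up(2)] rep(2) by simp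
      have "rep ?c \<in> E (u, p) (Suc (t (u, p) + Suc n))"
        using 1 w rep(1) by (auto simp: E_def reach_Suc)
      moreover have "rep ?c \<notin> E (u, p) (t (u, p) - (n+2))"
      proof
        assume "rep ?c \<in> E (u, p) (t (u, p) - (n+2))"
        then have "x \<in> E (u, p) (Suc (t (u, p) - (n+2)))"
          using sym[OF w] x by (auto simp: E_def reach_Suc)
        moreover have "Suc (t (u, p) - (n+2)) = t (u, p) - Suc n"
          using t_ge[of "(u, p)"] by auto
        ultimately show False
          using 2 closure_subset by auto
      qed
      ultimately have "q (u, p) \<in> F ?c (u, p)"
        unfolding F_def t_def by simp
      then show "i \<in> {i \<in> G \<times> P. q i \<in> F ?c i}"
        using up by simp
    qed
    then have "card {i \<in> G \<times> P. x \<in> E i (t i + Suc n) \<and> x \<notin> closure (E i (t i - Suc n))}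
      \<le> card {i \<in> G \<times> P. q i \<in> F ?c i}"
      using fin by (intro card_mono) auto
    also have "\<dots> \<le> n"
      using q(2) \<Phi>(1) x by auto
    finally show "card {i \<in> G \<times> P. x \<in> E i (t i + Suc n) \<and> x \<notin> closure (E i (t i - Suc n))} \<le> n" .
  qed (use E_open E_cl in auto)
  then obtain U where U: "open_cover X U" "cover_ord U \<le> enat n"
      "\<forall>A\<in>U. \<forall>x\<in>A. \<forall>y\<in>A. \<forall>i\<in>G \<times> P. x \<in> E i 0 \<longrightarrow> y \<in> E i (t i)"
    by (elim exE conjE)
  have "\<exists>p\<in>P. \<exists>s\<le>(2*n+4)*Q. \<exists>b\<in>B p. \<rho> u x \<in> B p \<and> (W ^^ s) b (\<rho> u y)"
    if A: "A \<in> U" "x \<in> A" "y \<in> A" and u: "u \<in> G" for A x y u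
  proof -
    have x: "x \<in> X"
      using U(1) A unfolding open_cover_def by auto
    then obtain p where p: "p \<in> P" "\<rho> u x \<in> B p"
      using \<rho>(2)[OF u] B(2) by blast
    then have "x \<in> E (u, p) 0"
      using x unfolding E_def by (simp add: reach_0)
    then have "y \<in> E (u, p) (t (u, p))"
      using U(3)[rule_format, OF A, of "(u, p)"] u p(1) by simp
    then obtain b where "b \<in> B p" "(W ^^ t (u, p)) b (\<rho> u y)"
      unfolding E_def reach_def by auto
    then show ?thesis
      using p t_le[of "(u, p)"] u by blast
  qed
  then show ?thesis
    using U by blast
qed

subsection \<open>Entourages of an expansive action\<close>

text \<open>Halving: each half of a chain of at most \<open>2 ^ Suc j\<close> steps collapses by
  induction to one step of \<open>W (Suc m)\<close>, and two such steps compose to one of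
  \<open>W m\<close>.\<close>

lemma chain_collapse:
  fixes W :: "nat \<Rightarrow> 'a \<Rightarrow> 'a \<Rightarrow> bool"
  assumes WX: "\<And>n x y. W n x y \<Longrightarrow> y \<in> X"
    and refl: "\<And>n x. x \<in> X \<Longrightarrow> W n x x"
    and comp: "\<And>n x y z. W (Suc n) x y \<Longrightarrow> W (Suc n) y z \<Longrightarrow> W n x z"
  shows "x \<in> X \<Longrightarrow> s \<le> 2 ^ j \<Longrightarrow> (W (m + j) ^^ s) x y \<Longrightarrow> W m x y"
proof (induction j arbitrary: s x y m)
  case 0
  then have "s = 0 \<or> s = 1"
    by auto
  then show ?case
    using 0 refl by auto
next
  case (Suc j)
  define s1 where "s1 = s div 2"
  define s2 where "s2 = s - s1"
  have s: "s = s1 + s2" "s1 \<le> 2 ^ j" "s2 \<le> 2 ^ j"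
    using Suc.prems(2) unfolding s1_def s2_def by auto
  obtain z where z: "(W (Suc m + j) ^^ s1) x z" "(W (Suc m + j) ^^ s2) z y"
    using Suc.prems(3) unfolding s(1) relpowp_add by auto
  have xz: "W (Suc m) x z"
    using Suc.IH[OF Suc.prems(1) s(2) z(1)] .
  then have "W (Suc m) z y"
    using Suc.IH[OF _ s(3) z(2)] WX by blast
  then show ?case
    using comp xz by blast
qed

section \<open>Cubes in the integer lattice\<close>

lemma cube_pts_subset_Zk: "cube_pts m N \<subseteq> Zk m"
  unfolding cube_pts_def by auto

lemma zero_in_cube_pts: "0 \<in> cube_pts m N"
  unfolding cube_pts_def Zk_def by auto

lemma cube_pts_mono: "N \<le> M \<Longrightarrow> cube_pts m N \<subseteq> cube_pts m M"
  unfolding cube_pts_def by force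

lemma cube_pts_add: "u \<in> cube_pts m N \<Longrightarrow> v \<in> cube_pts m M \<Longrightarrow> u + v \<in> cube_pts m (N + M)"
  unfolding cube_pts_def Zk_def by (auto intro!: order.trans[OF abs_triangle_ineq] add_mono)

lemma cube_pts_0: "cube_pts m 0 = {0}"
  unfolding cube_pts_def Zk_def by (auto simp: fun_eq_iff not_le) (meson not_le)

text \<open>Subtracting the vector of signs moves every nonzero coordinate one unit towards 0. By
  iteration, elements of a cube of radius \<open>N\<close> are sums of \<open>N\<close> elements of
  the unit cube.\<close>

lemma cube_pts_Suc:
  assumes "u \<in> cube_pts m (Suc N)"
  shows "\<exists>g\<in>cube_pts m 1. \<exists>u'\<in>cube_pts m N. u = g + u'"
proof (intro bexI)
  show "(\<lambda>i. sgn (u i)) \<in> cube_pts m 1"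
    using assms unfolding cube_pts_def Zk_def by (auto simp: sgn_if)
  show "(\<lambda>i. u i - sgn (u i)) \<in> cube_pts m N"
    using assms unfolding cube_pts_def Zk_def by (force simp: sgn_if)
qed auto

lemma Zk_in_cube_pts:
  assumes "u \<in> Zk m"
  shows "\<exists>N. u \<in> cube_pts m N"
proof -
  have "\<bar>u i\<bar> \<le> (\<Sum>j<m. \<bar>u j\<bar>)" if "i < m" for i
    using that by (intro member_le_sum) auto
  then have "u \<in> cube_pts m (nat (\<Sum>j<m. \<bar>u j\<bar>))"
    using assms unfolding cube_pts_def by auto
  then show ?thesis
    by blast
qed

lemma cube_pts_finite_card:
  shows finite_cube_pts: "finite (cube_pts m N)"
    and card_cube_pts_le: "card (cube_pts m N) \<le> (2 * N + 1) ^ m"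
proof -
  \<comment> \<open>Points of the cube vanish from index \<open>m\<close> on, so restriction embeds
    the cube into a finite product of intervals.\<close>
  define r where "r u = restrict u {..<m}" for u :: "nat \<Rightarrow> int"
  define P where "P = PiE {..<m} (\<lambda>_. {- int N..int N})"
  have inj: "inj_on r (cube_pts m N)"
  proof (rule inj_onI, rule ext)
    fix u v i assume uv: "u \<in> cube_pts m N" "v \<in> cube_pts m N" and "r u = r v"
    then have "r u i = r v i"
      by simp
    then show "u i = v i"
      using uv unfolding cube_pts_def Zk_def r_def by (cases "i < m") auto
  qed
  have sub: "r ` cube_pts m N \<subseteq> P"
    unfolding r_def P_def image_subset_iff restrict_PiE_iff
    by (auto simp: cube_pts_def abs_le_iff)
  have fin: "finite P"
    unfolding P_def by (intro finite_PiE) auto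
  have "nat (int N + int N + 1) = 2 * N + 1"
    by simp
  then have "card P = (2 * N + 1) ^ m"
    unfolding P_def by (simp add: card_PiE)
  then show "finite (cube_pts m N)" "card (cube_pts m N) \<le> (2 * N + 1) ^ m"
    using inj_on_finite[OF inj sub fin] card_inj_on_le[OF inj sub fin] by auto
qed

section \<open>Closeness of orbits over cubes\<close>

definition bowen_close ::
  "nat \<Rightarrow> 'a::metric_space set \<Rightarrow> ((nat \<Rightarrow> int) \<Rightarrow> 'a \<Rightarrow> 'a) \<Rightarrow> real \<Rightarrow> nat \<Rightarrow> 'a \<Rightarrow> 'a \<Rightarrow> bool" where
  "bowen_close k X T c n x y \<longleftrightarrow>
     x \<in> X \<and> y \<in> X \<and> (\<forall>v\<in>cube_pts k n. dist (T v x) (T v y) < c)"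

lemma bowen_close_in:
  "bowen_close k X T c n x y \<Longrightarrow> x \<in> X" "bowen_close k X T c n x y \<Longrightarrow> y \<in> X"
  unfolding bowen_close_def by auto

lemma bowen_close_refl: "c > 0 \<Longrightarrow> x \<in> X \<Longrightarrow> bowen_close k X T c n x x"
  unfolding bowen_close_def by auto

lemma bowen_close_sym: "bowen_close k X T c n x y \<Longrightarrow> bowen_close k X T c n y x"
  unfolding bowen_close_def by (auto simp: dist_commute)

lemma bowen_close_mono: "bowen_close k X T c n x y \<Longrightarrow> m \<le> n \<Longrightarrow> bowen_close k X T c m x y"
  unfolding bowen_close_def using cube_pts_mono by blast

text \<open>The cube of radius \<open>m\<close> translated by \<open>v\<close> lies in the cube of
  radius \<open>n + m\<close>.\<close>

lemma bowen_close_shift: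
  assumes "cont_action k X T" "bowen_close k X T c (n + m) x y" "v \<in> cube_pts k n"
  shows "bowen_close k X T c m (T v x) (T v y)"
proof -
  have X: "x \<in> X" "y \<in> X"
    using assms(2) bowen_close_in by blast+
  have v: "v \<in> Zk k"
    using assms(3) cube_pts_subset_Zk by blast
  then have "T v x \<in> X" "T v y \<in> X"
    using assms(1) X unfolding cont_action_def by blast+
  moreover have "dist (T w (T v x)) (T w (T v y)) < c" if w: "w \<in> cube_pts k m" for w
  proof -
    have "w \<in> Zk k"
      using w cube_pts_subset_Zk by blast
    then have "T (w + v) x = T w (T v x)" "T (w + v) y = T w (T v y)"
      using assms(1) X v unfolding cont_action_def by blast+
    moreover have "w + v \<in> cube_pts k (n + m)"
      using cube_pts_add[OF w assms(3)] by (simp add: add.commute)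
    ultimately show ?thesis
      using assms(2) unfolding bowen_close_def by metis
  qed
  ultimately show ?thesis
    unfolding bowen_close_def by blast
qed

lemma openin_bowen_close:
  assumes T: "cont_action k X T" and x: "x \<in> X"
  shows "openin (top_of_set X) {y. bowen_close k X T c n x y}"
proof -
  have "openin (top_of_set X) (\<Inter>v\<in>cube_pts k n. X \<inter> T v -` ball (T v x) c)"
  proof (rule openin_INT2)
    fix v assume "v \<in> cube_pts k n"
    then have "continuous_on X (T v)"
      using T cube_pts_subset_Zk unfolding cont_action_def by blast
    then show "openin (top_of_set X) (X \<inter> T v -` ball (T v x) c)"
      by (intro continuous_openin_preimage_gen) auto
  qed (use finite_cube_pts zero_in_cube_pts in blast)+
  moreover have "{y. bowen_close k X T c n x y} = (\<Inter>v\<in>cube_pts k n. X \<inter> T v -` ball (T v x) c)"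
    using x zero_in_cube_pts unfolding bowen_close_def by auto
  ultimately show ?thesis
    by simp
qed

text \<open>By compactness: otherwise pairs at distance at least \<open>\<eta>\<close> that are
  close on larger and larger cubes accumulate at a pair of distinct points that no
  \<open>T v\<close> separates by more than \<open>c\<close>.\<close>

lemma bowen_close_imp_close:
  assumes "compact X" and T: "cont_action k X T"
    and c: "\<And>x y. x \<in> X \<Longrightarrow> y \<in> X \<Longrightarrow> x \<noteq> y \<Longrightarrow> \<exists>u\<in>Zk k. dist (T u x) (T u y) > c"
    and "\<eta> > 0"
  shows "\<exists>n. \<forall>x y. bowen_close k X T c n x y \<longrightarrow> dist x y < \<eta>"
proof (rule ccontr)
  assume "\<not> ?thesis"
  then have "\<forall>n. \<exists>x y. bowen_close k X T c n x y \<and> \<not> dist x y < \<eta>"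
    by blast
  then obtain f g where fg: "\<And>n. bowen_close k X T c n (f n) (g n)" "\<And>n. dist (f n) (g n) \<ge> \<eta>"
    by (metis not_less)
  have X: "f n \<in> X" "g n \<in> X" for n
    using fg(1) bowen_close_in by blast+
  have "seq_compact (X \<times> X)"
    using \<open>compact X\<close> compact_Times compact_eq_seq_compact_metric by blast
  moreover have "\<forall>n. (f n, g n) \<in> X \<times> X"
    using X by simp
  ultimately obtain ab r where "ab \<in> X \<times> X" and r: "strict_mono (r::nat\<Rightarrow>nat)"
    and "((\<lambda>n. (f n, g n)) \<circ> r) \<longlonglongrightarrow> ab"
    by (rule seq_compactE)
  then obtain a b where ab: "a \<in> X" "b \<in> X" and lim: "((\<lambda>n. (f n, g n)) \<circ> r) \<longlonglongrightarrow> (a, b)"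
    by (cases ab) auto
  have f: "(\<lambda>n. f (r n)) \<longlonglongrightarrow> a" and g: "(\<lambda>n. g (r n)) \<longlonglongrightarrow> b"
    using tendsto_fst[OF lim] tendsto_snd[OF lim] by (simp_all add: o_def)
  have "dist a b \<ge> \<eta>"
    by (rule tendsto_lowerbound[OF tendsto_dist[OF f g]]) (use fg(2) in auto)
  then have "a \<noteq> b"
    using \<open>\<eta> > 0\<close> by auto
  then obtain v where v: "v \<in> Zk k" "dist (T v a) (T v b) > c"
    using c[OF ab] by blast
  then obtain M where M: "v \<in> cube_pts k M"
    using Zk_in_cube_pts by blast
  have "continuous_on X (T v)"
    using T v unfolding cont_action_def by blast
  then have "(\<lambda>n. T v (f (r n))) \<longlonglongrightarrow> T v a" "(\<lambda>n. T v (g (r n))) \<longlonglongrightarrow> T v b"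
    by (auto intro!: continuous_on_tendsto_compose[OF _ f] continuous_on_tendsto_compose[OF _ g]
        always_eventually ab X)
  then have *: "(\<lambda>n. dist (T v (f (r n))) (T v (g (r n)))) \<longlonglongrightarrow> dist (T v a) (T v b)"
    by (rule tendsto_dist)
  have "dist (T v (f (r n))) (T v (g (r n))) \<le> c" if "n \<ge> M" for n
  proof -
    have "M \<le> r n"
      using that seq_suble[OF r, of n] by simp
    then have "v \<in> cube_pts k (r n)"
      using M cube_pts_mono by blast
    then show ?thesis
      using fg(1)[of "r n"] unfolding bowen_close_def by (meson less_imp_le)
  qed
  \<comment> \<open>Only the non-strict bound survives the limit; it suffices since expansiveness
    separates by strictly more than \<open>c\<close>.\<close>
  then have "dist (T v a) (T v b) \<le> c"
    by (intro tendsto_upperbound[OF *]) (auto simp: eventually_sequentially)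
  then show False
    using v by simp
qed

text \<open>A point is coded by recording, for each \<open>v\<close> in the cube, a ball of radius
  \<open>c/2\<close> from a fixed finite net that contains \<open>T v x\<close>; equal codes then
  force distances below \<open>c\<close>. The net does not depend on \<open>n\<close>, so neither
  does \<open>b\<close>.\<close>

lemma itinerary_code:
  assumes "compact X" and T: "cont_action k X T" and "c > 0"
  shows "\<exists>b. \<forall>n. \<exists>(\<Phi> :: 'a::metric_space \<Rightarrow> (nat \<Rightarrow> int) \<Rightarrow> 'a) C.
    finite C \<and> card C \<le> 2 ^ (b * (2 * n + 1) ^ k) \<and> \<Phi> ` X \<subseteq> C \<and>
    (\<forall>x\<in>X. \<forall>y\<in>X. \<Phi> x = \<Phi> y \<longrightarrow> bowen_close k X T c n x y)"
proof -
  obtain D where D: "finite D" "X \<subseteq> (\<Union>p\<in>D. ball p (c/2))"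
    using seq_compact_imp_totally_bounded[OF compact_imp_seq_compact[OF \<open>compact X\<close>]] \<open>c > 0\<close>
    by (meson half_gt_zero)
  define code where "code x = (SOME p. p \<in> D \<and> dist p x < c/2)" for x
  have code: "code x \<in> D" "dist (code x) x < c/2" if "x \<in> X" for x
  proof -
    have "\<exists>p. p \<in> D \<and> dist p x < c/2"
      using D(2) that unfolding ball_def by blast
    then show "code x \<in> D" "dist (code x) x < c/2"
      unfolding code_def by (rule someI2_ex; blast)+
  qed
  show ?thesis
  proof (intro exI allI conjI)
    fix n
    define C where "C = PiE (cube_pts k n) (\<lambda>_. D)"
    define \<Phi> where "\<Phi> x = restrict (\<lambda>v. code (T v x)) (cube_pts k n)" for x
    have TX: "T v x \<in> X" if "v \<in> cube_pts k n" "x \<in> X" for v x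
      using T that cube_pts_subset_Zk unfolding cont_action_def by blast
    show "finite C"
      unfolding C_def using D finite_cube_pts by (intro finite_PiE) auto
    have "card C = card D ^ card (cube_pts k n)"
      unfolding C_def by (simp add: card_PiE finite_cube_pts)
    \<comment> \<open>Passing to base 2 in this crude way avoids logarithms and yields the witness
      \<open>b = card D\<close>.\<close>
    also have "\<dots> \<le> (2 ^ card D) ^ card (cube_pts k n)"
      by (intro power_mono[OF less_imp_le[OF less_exp]]) simp
    also have "\<dots> \<le> (2 ^ card D) ^ ((2 * n + 1) ^ k)"
      by (intro power_increasing card_cube_pts_le) auto
    finally show "card C \<le> 2 ^ (card D * (2 * n + 1) ^ k)"
      by (simp add: power_mult)
    show "\<Phi> ` X \<subseteq> C"
      unfolding \<Phi>_def C_def using code TX by auto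
    show "\<forall>x\<in>X. \<forall>y\<in>X. \<Phi> x = \<Phi> y \<longrightarrow> bowen_close k X T c n x y"
    proof (intro ballI impI)
      fix x y assume xy: "x \<in> X" "y \<in> X" "\<Phi> x = \<Phi> y"
      have "dist (T v x) (T v y) < c" if v: "v \<in> cube_pts k n" for v
      proof -
        have "code (T v x) = code (T v y)"
          using fun_cong[OF xy(3), of v] v unfolding \<Phi>_def by simp
        then show ?thesis
          using code(2)[OF TX[OF v xy(1)]] code(2)[OF TX[OF v xy(2)]]
            dist_triangle_half_r[of "code (T v x)" "T v x" c "T v y"] by simp
      qed
      then show "bowen_close k X T c n x y"
        using xy unfolding bowen_close_def by blast
    qed
  qed
qed

text \<open>Polynomial factors are negligible against \<open>2 ^ (N - N div 2)\<close>. This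
  guarantees that chains as long as the largest threshold still collapse.\<close>

lemma eventually_poly_le_exp:
  fixes D a j :: nat
  shows "\<forall>\<^sub>F N in sequentially. D * (2 * N + 1) ^ j * 2 ^ (N div 2) \<le> (2::nat) ^ (N - a)"
proof -
  have "\<forall>\<^sub>F N in sequentially. real D * 2 ^ a * (2 * real N + 1) ^ j \<le> 2 powr (real N / 2)"
    by real_asymp
  then show ?thesis
    using eventually_ge_at_top[of a]
  proof eventually_elim
    case (elim N)
    \<comment> \<open>Both sides are multiplied by \<open>2 ^ a\<close> to replace the natural
      subtraction \<open>N - a\<close> by \<open>N\<close>.\<close>
    have "real (D * (2 * N + 1) ^ j * 2 ^ (N div 2)) * 2 ^ a =
        real D * 2 ^ a * (2 * real N + 1) ^ j * 2 ^ (N div 2)"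
      by (simp add: add.commute)
    also have "\<dots> \<le> 2 powr (real N / 2) * 2 powr (real N / 2)"
    proof (intro mult_mono)
      have "real (N div 2) \<le> real N / 2"
        by linarith
      then show "2 ^ (N div 2) \<le> 2 powr (real N / 2)"
        by (simp flip: powr_realpow)
    qed (use elim in auto)
    also have "\<dots> = 2 ^ N"
      by (simp flip: powr_add powr_realpow)
    also have "\<dots> = real (2 ^ (N - a)) * 2 ^ a"
      using elim by (simp flip: power_add)
    finally show ?case
      by (simp only: mult_le_cancel_right of_nat_le_iff) simp
  qed
qed

text \<open>\<open>L\<close> is so large that closeness over the cube of radius \<open>L\<close>
  implies distance below \<open>c/2\<close> and also meets the uniform continuity requirement of
  each \<open>R g\<close>. Shifting by \<open>v\<close> in the cube of radius \<open>n\<close>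
  brings pairs close at radius \<open>n + L\<close> into this situation; then the triangle
  inequality gives the first claim, and \<open>T v (R g x) = R g (T v x)\<close> the second.\<close>

lemma expansive_scale:
  assumes "compact X" and T: "cont_action k X T" and R: "cont_action l X R"
    and comm: "\<And>v u x. v \<in> Zk k \<Longrightarrow> u \<in> Zk l \<Longrightarrow> x \<in> X \<Longrightarrow> T v (R u x) = R u (T v x)"
    and "c > 0"
    and c: "\<And>x y. x \<in> X \<Longrightarrow> y \<in> X \<Longrightarrow> x \<noteq> y \<Longrightarrow> \<exists>u\<in>Zk k. dist (T u x) (T u y) > c"
  shows "\<exists>L\<ge>1.
    (\<forall>n x y z. bowen_close k X T c (n + L) x y \<longrightarrow> bowen_close k X T c (n + L) y z \<longrightarrow>
       bowen_close k X T c n x z) \<and>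
    (\<forall>n x y. \<forall>g\<in>cube_pts l 1. bowen_close k X T c (n + L) x y \<longrightarrow>
       bowen_close k X T c n (R g x) (R g y))"
proof -
  let ?W = "bowen_close k X T c"
  note close = bowen_close_imp_close[OF \<open>compact X\<close> T c]
  obtain n0 where n0: "\<And>x y. ?W n0 x y \<Longrightarrow> dist x y < c/2"
    using close[of "c/2"] \<open>c > 0\<close> by auto
  have "\<forall>g\<in>cube_pts l 1. \<exists>n. \<forall>x y. ?W n x y \<longrightarrow> dist (R g x) (R g y) < c"
  proof
    fix g assume "g \<in> cube_pts l 1"
    then have "continuous_on X (R g)"
      using R cube_pts_subset_Zk unfolding cont_action_def by blast
    then have "uniformly_continuous_on X (R g)"
      using \<open>compact X\<close> compact_uniformly_continuous by blast
    then obtain \<eta> where "\<eta> > 0"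
      "\<And>x y. x \<in> X \<Longrightarrow> y \<in> X \<Longrightarrow> dist y x < \<eta> \<Longrightarrow> dist (R g y) (R g x) < c"
      using \<open>c > 0\<close> unfolding uniformly_continuous_on_def by metis
    moreover obtain n where "\<And>x y. ?W n x y \<Longrightarrow> dist x y < \<eta>"
      using close[OF _ _ _ \<open>\<eta> > 0\<close>] by blast
    ultimately show "\<exists>n. \<forall>x y. ?W n x y \<longrightarrow> dist (R g x) (R g y) < c"
      by (meson bowen_close_in)
  qed
  then obtain f where f: "\<And>g x y. g \<in> cube_pts l 1 \<Longrightarrow> ?W (f g) x y \<Longrightarrow> dist (R g x) (R g y) < c"
    by metis
  \<comment> \<open>The sum serves as an upper bound for finitely many \<open>f g\<close>;
    \<open>Suc\<close> makes \<open>L\<close> positive.\<close>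
  define L where "L = Suc n0 + (\<Sum>g\<in>cube_pts l 1. f g)"
  have f_le: "f g \<le> L" if "g \<in> cube_pts l 1" for g
    using member_le_sum[OF that, of f] finite_cube_pts[of l 1] unfolding L_def by auto
  have L: "L \<ge> 1" "n0 \<le> L"
    unfolding L_def by auto
  have "?W n x z" if xyz: "?W (n + L) x y" "?W (n + L) y z" for n x y z
  proof -
    have "dist (T v x) (T v z) < c" if v: "v \<in> cube_pts k n" for v
    proof -
      have "?W L (T v x) (T v y)" "?W L (T v y) (T v z)"
        using bowen_close_shift[OF T _ v] xyz by auto
      then have "dist (T v x) (T v y) < c/2" "dist (T v y) (T v z) < c/2"
        using n0 bowen_close_mono L(2) by blast+
      then show ?thesis
        by (metis dist_commute dist_triangle_half_l)
    qed
    then show ?thesis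
      using xyz unfolding bowen_close_def by auto
  qed
  moreover have "?W n (R g x) (R g y)" if g: "g \<in> cube_pts l 1" and xy: "?W (n + L) x y" for n x y g
  proof -
    have gZ: "g \<in> Zk l"
      using g cube_pts_subset_Zk by blast
    have X: "x \<in> X" "y \<in> X"
      using xy bowen_close_in by blast+
    then have "R g x \<in> X" "R g y \<in> X"
      using R gZ unfolding cont_action_def by blast+
    moreover have "dist (T v (R g x)) (T v (R g y)) < c" if v: "v \<in> cube_pts k n" for v
    proof -
      have "?W (f g) (T v x) (T v y)"
        using bowen_close_shift[OF T xy v] bowen_close_mono f_le[OF g] by blast
      moreover have "v \<in> Zk k"
        using v cube_pts_subset_Zk by blast
      ultimately show ?thesis
        using f[OF g] comm[OF _ gZ] X by metis
    qed
    ultimately show ?thesis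
      unfolding bowen_close_def by blast
  qed
  ultimately show ?thesis
    using L by blast
qed

section \<open>From covers to mean dimension\<close>

lemma widim_leI:
  assumes "open_cover X U" "cover_ord U \<le> n"
    and "\<And>A x y. A \<in> U \<Longrightarrow> x \<in> A \<Longrightarrow> y \<in> A \<Longrightarrow> \<rho> x y \<le> \<epsilon>"
  shows "widim X \<rho> \<epsilon> \<le> n"
proof -
  have "mesh \<rho> U \<le> ereal \<epsilon>"
    unfolding mesh_def using assms(3) by (intro SUP_least) auto
  then show ?thesis
    unfolding widim_def using assms(1,2) by (intro INF_lower2[of U]) auto
qed

theorem theorem1p4:
  fixes X :: "'a::metric_space set"
    and T R :: "(nat \<Rightarrow> int) \<Rightarrow> 'a \<Rightarrow> 'a"
    and k :: nat
  assumes "k \<ge> 1"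
    and "compact X"
    and "cont_action k X T"
    and "expansive k X T"
    and "cont_action (k - 1) X R"
    and "\<forall>v\<in>Zk k. \<forall>u\<in>Zk (k - 1). \<forall>x\<in>X. T v (R u x) = R u (T v x)"
  shows "mdim (k - 1) X R < \<infinity>"
proof -
  define l where "l = k - 1"
  have kl: "k = Suc l"
    using assms(1) l_def by simp
  note T = assms(3)
  have R: "cont_action l X R"
    using assms(5) l_def by simp
  obtain c where "c > 0"
    and c: "\<And>x y. x \<in> X \<Longrightarrow> y \<in> X \<Longrightarrow> x \<noteq> y \<Longrightarrow> \<exists>u\<in>Zk k. dist (T u x) (T u y) > c"
    using assms(4) unfolding expansive_def by auto
  obtain L where "L \<ge> 1"
    and L_comp: "\<And>n x y z. bowen_close k X T c (n + L) x y \<Longrightarrow> bowen_close k X T c (n + L) y z \<Longrightarrow>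
       bowen_close k X T c n x z"
    and L_R: "\<And>n x y g. g \<in> cube_pts l 1 \<Longrightarrow> bowen_close k X T c (n + L) x y \<Longrightarrow>
       bowen_close k X T c n (R g x) (R g y)"
    using expansive_scale[OF assms(2) T R _ \<open>c > 0\<close> c] assms(6) l_def by blast
  obtain b where b: "\<And>n. \<exists>(\<Phi> :: 'a \<Rightarrow> (nat \<Rightarrow> int) \<Rightarrow> 'a) C.
      finite C \<and> card C \<le> 2 ^ (b * (2 * n + 1) ^ k) \<and> \<Phi> ` X \<subseteq> C \<and>
      (\<forall>x\<in>X. \<forall>y\<in>X. \<Phi> x = \<Phi> y \<longrightarrow> bowen_close k X T c n x y)"
    using itinerary_code[OF assms(2) T \<open>c > 0\<close>] by blast
  \<comment> \<open>With radii in multiples of \<open>L\<close>, one composition or one application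
    of a generator of \<open>R\<close> costs exactly one index.\<close>
  define W where "W n = bowen_close k X T c (n * L)" for n
  have W_in: "x \<in> X \<and> y \<in> X" if "W n x y" for n x y
    using that bowen_close_in unfolding W_def by blast
  have W_refl: "W n x x" if "x \<in> X" for n x
    using that bowen_close_refl \<open>c > 0\<close> unfolding W_def by blast
  have W_sym: "W n y x" if "W n x y" for n x y
    using that bowen_close_sym unfolding W_def by blast
  have W_open: "openin (top_of_set X) {y. W n x y}" if "x \<in> X" for n x
    using that openin_bowen_close[OF T] unfolding W_def by blast
  have W_comp: "W n x z" if "W (Suc n) x y" "W (Suc n) y z" for n x y z
    using that L_comp[of "n * L" x y z] unfolding W_def by (simp add: add.commute)
  have W_Suc: "W n x y" if "W (Suc n) x y" for n x y
    using that W_comp W_refl W_in by blast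
  have W_R1: "W n (R g x) (R g y)" if "W (Suc n) x y" "g \<in> cube_pts l 1" for n x y g
    using that L_R[of g "n * L" x y] unfolding W_def by (simp add: add.commute)
  have W_R: "W n (R u x) (R u y)" if "W (N + n) x y" "u \<in> cube_pts l N" for N n x y u
    using that
  proof (induction N arbitrary: u n)
    case 0
    then have "u = 0"
      using cube_pts_0 by blast
    then have "R u x = x" "R u y = y"
      using R W_in[OF 0(1)] unfolding cont_action_def by blast+
    then show ?case
      using 0 by simp
  next
    case (Suc N)
    obtain g u' where gu: "g \<in> cube_pts l 1" "u' \<in> cube_pts l N" "u = g + u'"
      using cube_pts_Suc[OF Suc.prems(2)] by blast
    have "W (Suc n) (R u' x) (R u' y)"
      using Suc.IH[of "Suc n" u'] gu Suc.prems by simp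
    then have "W n (R g (R u' x)) (R g (R u' y))"
      using W_R1 gu(1) by blast
    moreover have "g \<in> Zk l" "u' \<in> Zk l"
      using gu cube_pts_subset_Zk by blast+
    then have "R u x = R g (R u' x)" "R u y = R g (R u' y)"
      using R W_in[OF Suc.prems(1)] unfolding gu(3) cont_action_def by blast+
    ultimately show ?case
      by simp
  qed
  \<comment> \<open>Chosen so that the number of itineraries over the cube of radius
    \<open>2 * N * L\<close> is at most \<open>2 ^ ((N div 2) * n)\<close> for
    \<open>n = D * (2 * N + 1) ^ l\<close>. It is fixed before \<open>\<epsilon>\<close>.\<close>
  define D where "D = 8 * b * (2 * L) ^ k"
  have widim_le: "\<forall>\<^sub>F N in sequentially. widim X (dyn_dist l R N) \<epsilon> \<le> enat (D * (2 * N + 1) ^ l)"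
    if \<epsilon>: "\<epsilon> > 0" for \<epsilon> :: real
  proof -
    obtain m where m: "\<And>x y. bowen_close k X T c m x y \<Longrightarrow> dist x y < \<epsilon>"
      using bowen_close_imp_close[OF assms(2) T c \<epsilon>] by blast
    have Wm: "dist x y < \<epsilon>" if "W m x y" for x y
      using m bowen_close_mono[of k X T c "m * L" x y m] that \<open>L \<ge> 1\<close> unfolding W_def by simp
    \<comment> \<open>Two spare indices for the final comparison: one to join two points of the same
      \<open>B p\<close>, one to append the collapsed chain.\<close>
    define a where "a = m + 2"
    define B where "B p = {y. W a p y}" for p
    have "\<exists>\<D>\<subseteq>B ` X. finite \<D> \<and> X \<subseteq> \<Union>\<D>"
    proof -
      have "\<forall>A\<in>B ` X. openin (top_of_set X) A"
        using W_open unfolding B_def by blast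
      moreover have "X \<subseteq> \<Union>(B ` X)"
        using W_refl unfolding B_def by blast
      ultimately show ?thesis
        using assms(2) unfolding compact_eq_openin_cover by presburger
    qed
    then obtain P where P: "P \<subseteq> X" "finite P" "X \<subseteq> (\<Union>p\<in>P. B p)"
      by (metis finite_subset_image)
    \<comment> \<open>The part of the bound on \<open>(2 * n + 4) * (K + 1)\<close> that is
      independent of \<open>N\<close>. Both factors contribute \<open>(2 * N + 1) ^ l\<close>, hence
      the exponent \<open>2 * l\<close> below.\<close>
    define D' where "D' = (2 * D + 4) * (card P + 1)"
    have "\<forall>\<^sub>F N in sequentially. D' * (2 * N + 1) ^ (2 * l) * 2 ^ (N div 2) \<le> 2 ^ (N - a)"
      by (rule eventually_poly_le_exp)
    then show ?thesis
      using eventually_ge_at_top[of "a + 2"]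
    proof eventually_elim
      case (elim N)
      define n where "n = D * (2 * N + 1) ^ l"
      define G where "G = cube_pts l N"
      define K where "K = card G * card P"
      \<comment> \<open>In the count, \<open>K + 1\<close> beats the factor \<open>K\<close> and
        \<open>2 ^ (N div 2)\<close> pays for the itineraries; the remaining half of the exponent
        \<open>N\<close> leaves room for the chain length.\<close>
      define Q where "Q = (K + 1) * 2 ^ (N div 2)"
      obtain \<Phi> :: "'a \<Rightarrow> (nat \<Rightarrow> int) \<Rightarrow> 'a" and C where C: "finite C"
          "card C \<le> 2 ^ (b * (2 * (2 * N * L) + 1) ^ k)" "\<Phi> ` X \<subseteq> C"
          "\<And>x y. x \<in> X \<Longrightarrow> y \<in> X \<Longrightarrow> \<Phi> x = \<Phi> y \<Longrightarrow> bowen_close k X T c (2 * N * L) x y"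
        using b[of "2 * N * L"] by blast
      \<comment> \<open>Index \<open>2 * N\<close>, because applying \<open>R u\<close> with
        \<open>u\<close> in the cube of radius \<open>N\<close> costs \<open>N\<close> and must
        leave \<open>W N\<close>.\<close>
      have \<Phi>: "W (N + N) x y" if "x \<in> X" "y \<in> X" "\<Phi> x = \<Phi> y" for x y
        using C(4)[OF that] unfolding W_def by (simp add: mult_2)
      have len: "(2 * n + 4) * Q \<le> 2 ^ (N - a)"
      proof -
        have one: "1 \<le> (2 * N + 1) ^ l"
          by simp
        have "card G \<le> (2 * N + 1) ^ l"
          unfolding G_def by (rule card_cube_pts_le)
        then have "K + 1 \<le> (2 * N + 1) ^ l * card P + (2 * N + 1) ^ l"
          unfolding K_def using one by (intro add_mono mult_le_mono) auto
        then have K: "K + 1 \<le> (card P + 1) * (2 * N + 1) ^ l"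
          by (simp add: algebra_simps)
        have n: "2 * n + 4 \<le> (2 * D + 4) * (2 * N + 1) ^ l"
          unfolding n_def using one by (simp add: algebra_simps)
        have "(2 * n + 4) * (K + 1) \<le> (2 * D + 4) * (2 * N + 1) ^ l * ((card P + 1) * (2 * N + 1) ^ l)"
          using mult_le_mono[OF n K] .
        also have "\<dots> = D' * (2 * N + 1) ^ (2 * l)"
          unfolding D'_def mult_2[of l] power_add by (simp only: mult_ac)
        finally have "(2 * n + 4) * (K + 1) * 2 ^ (N div 2) \<le> D' * (2 * N + 1) ^ (2 * l) * 2 ^ (N div 2)"
          by (rule mult_le_mono1)
        then show ?thesis
          using elim(1) unfolding Q_def mult.assoc[symmetric] by (rule le_trans)
      qed
      have count: "card C * K ^ Suc n < Q ^ Suc n"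
      proof -
        have "2 * (2 * N * L) + 1 \<le> 2 * L * (2 * N + 1)"
          using \<open>L \<ge> 1\<close> by (simp add: algebra_simps)
        then have "b * (2 * (2 * N * L) + 1) ^ k \<le> b * (2 * L * (2 * N + 1)) ^ k"
          by (intro mult_le_mono power_mono) auto
        \<comment> \<open>The rank of \<open>R\<close> matters here: since \<open>k = Suc l\<close>,
          only one factor \<open>2 * N + 1\<close> is left beyond \<open>(2 * N + 1) ^ l\<close>,
          and the linear exponent \<open>N div 2\<close> absorbs it.\<close>
        also have "\<dots> = b * (2 * L) ^ k * (2 * N + 1) ^ l * (2 * N + 1)"
          by (simp only: kl power_Suc power_mult_distrib mult_ac)
        also have "\<dots> \<le> b * (2 * L) ^ k * (2 * N + 1) ^ l * (8 * (N div 2))"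
        proof (rule mult_le_mono2)
          show "2 * N + 1 \<le> 8 * (N div 2)"
            using elim(2) by presburger
        qed
        also have "\<dots> = (N div 2) * n"
          unfolding n_def D_def by (simp only: mult_ac)
        also have "\<dots> \<le> (N div 2) * Suc n"
          by simp
        finally have "card C \<le> 2 ^ ((N div 2) * Suc n)"
          using C(2) by (meson le_trans one_le_numeral power_increasing)
        then have "card C * K ^ Suc n \<le> 2 ^ ((N div 2) * Suc n) * K ^ Suc n"
          by (rule mult_le_mono1)
        also have "\<dots> < 2 ^ ((N div 2) * Suc n) * (K + 1) ^ Suc n"
          by (intro mult_strict_left_mono power_strict_mono) auto
        also have "\<dots> = Q ^ Suc n"
          unfolding Q_def power_mult power_mult_distrib by (rule mult.commute)
        finally show ?thesis .
      qed
      have "\<exists>U. open_cover X U \<and> cover_ord U \<le> enat n \<and>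
        (\<forall>A\<in>U. \<forall>x\<in>A. \<forall>y\<in>A. \<forall>u\<in>G. \<exists>p\<in>P. \<exists>s\<le>(2*n+4)*Q. \<exists>b\<in>B p.
          R u x \<in> B p \<and> (W N ^^ s) b (R u y))"
      proof (rule entourage_chain_cover[where \<Phi> = \<Phi> and C = C])
        show "finite G"
          unfolding G_def by (rule finite_cube_pts)
        show "continuous_on X (R u)" "R u ` X \<subseteq> X" if "u \<in> G" for u
          using R that cube_pts_subset_Zk unfolding G_def cont_action_def by blast+
        show "openin (top_of_set X) (B p)" if "p \<in> P" for p
          using W_open P(1) that unfolding B_def by blast
        show "W N (R u x) (R u y)" if "x \<in> X" "y \<in> X" "u \<in> G" "\<Phi> x = \<Phi> y" for x y u
          using W_R[OF \<Phi>] that unfolding G_def by blast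
        show "card C * (card G * card P) ^ Suc n < Q ^ Suc n"
          using count unfolding K_def .
      qed (use P C W_in W_refl W_sym W_open in auto)
      then obtain U where U: "open_cover X U" "cover_ord U \<le> enat n"
        "\<forall>A\<in>U. \<forall>x\<in>A. \<forall>y\<in>A. \<forall>u\<in>G. \<exists>p\<in>P. \<exists>s\<le>(2*n+4)*Q. \<exists>b\<in>B p.
          R u x \<in> B p \<and> (W N ^^ s) b (R u y)"
        by (elim exE conjE)
      have "dyn_dist l R N x y \<le> \<epsilon>" if A: "A \<in> U" "x \<in> A" "y \<in> A" for A x y
        unfolding dyn_dist_def
      proof (rule cSUP_least)
        fix u assume "u \<in> cube_pts l N"
        then have "\<exists>p\<in>P. \<exists>s\<le>(2*n+4)*Q. \<exists>b\<in>B p. R u x \<in> B p \<and> (W N ^^ s) b (R u y)"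
          by (rule U(3)[unfolded G_def, rule_format, OF A])
        then obtain p s b where *: "s \<le> (2*n+4)*Q" "b \<in> B p" "R u x \<in> B p" "(W N ^^ s) b (R u y)"
          by blast
        have "b \<in> X"
          using *(2) W_in unfolding B_def by blast
        have "a + (N - a) = N"
          using elim(2) by simp
        \<comment> \<open>By \<open>len\<close> the chain has at most \<open>2 ^ (N - a)\<close>
          steps of \<open>W N\<close>, so it collapses through \<open>N - a\<close> indices down to
          \<open>a\<close>.\<close>
        then have "W a b (R u y)"
          using chain_collapse[of W X b s "N - a" a "R u y"] W_in W_refl W_comp \<open>b \<in> X\<close> *(1,4) len
          by (metis le_trans)
        moreover have "W (Suc m) (R u x) b"
          using *(2,3) W_sym W_comp[of "Suc m" "R u x" p b] unfolding B_def a_def by simp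
        ultimately have "W m (R u x) (R u y)"
          using W_comp W_Suc unfolding a_def by (metis add_2_eq_Suc')
        then show "dist (R u x) (R u y) \<le> \<epsilon>"
          using Wm by fastforce
      qed (use zero_in_cube_pts in blast)
      then show ?case
        using widim_leI[OF U(1,2)] unfolding n_def by blast
    qed
  qed
  have ev: "\<forall>\<^sub>F N in sequentially.
      ereal_of_enat (widim X (dyn_dist l R N) \<epsilon>) / ereal (real (2*N+1) ^ l) \<le> ereal D"
    if "\<epsilon> > 0" for \<epsilon> :: real
    using widim_le[OF that]
  proof (rule eventually_mono)
    fix N assume "widim X (dyn_dist l R N) \<epsilon> \<le> enat (D * (2 * N + 1) ^ l)"
    then have "ereal_of_enat (widim X (dyn_dist l R N) \<epsilon>) \<le> ereal (real (D * (2 * N + 1) ^ l))"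
      by (metis ereal_of_enat_le_iff ereal_of_enat_simps(1))
    also have "\<dots> = ereal (real (2*N+1) ^ l) * ereal D"
      by simp
    finally show "ereal_of_enat (widim X (dyn_dist l R N) \<epsilon>) / ereal (real (2*N+1) ^ l) \<le> ereal D"
      by (subst ereal_divide_le_pos) auto
  qed
  \<comment> \<open>The bound \<open>D\<close> serves every \<open>\<epsilon> > 0\<close>, so it
    passes through both upper limits.\<close>
  have "mdim l X R \<le> ereal D"
    unfolding mdim_def
    by (rule Limsup_bounded, rule eventually_mono[OF eventually_at_right_less])
       (rule Limsup_bounded, erule ev)
  then show ?thesis
    unfolding l_def by (metis PInfty_neq_ereal(1) ereal_infty_less(1) ereal_infty_less_eq(1))
qed

end
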